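(* Let $R$ be a weakly Rickart $*$-ring and let $K$ be a commutative $*$-ring with unity such that $R$ is a $*$-algebra over $K$. Assume that for every $\lambda\in K\setminus\{0\}$ there exists a projection $e_\lambda\in R$ such that for every $x\in R$ with $\lambda x=0$ one has $LP(x)\le e_\lambda$. Then $R$ can be embedded in a Rickart $*$-ring with preservation of right projections; that is, there exist a Rickart $*$-ring $S$ and an injective $*$-ring homomorphism $\varphi:R\to S$ such that for every $x\in R$ the right projection of $\varphi(x)$ in $S$ is $\varphi(RP(x))$.
   Context: Rings are associative and need not have a unity. A $*$-ring is a ring with an involution $x\mapsto x^*$ (an additive anti-automorphism of period at most two); a $*$-ring homomorphism is a ring homomorphism commuting with the involutions. A projection is an element $e$ with $e=e^*=e^2$; projections are ordered by $e\le f$ iff $ef=e$ (equivalently $fe=e$). A $*$-ring $S$ is a Rickart $*$-ring if for each $x\in S$ the right annihilator $r_S(\{x\})=\{y\in S: xy=0\}$ equals $eS$ for some projection $e\in S$ (such a ring automatically has a unity). A $*$-ring $R$ is a weakly Rickart $*$-ring if for every $x\in R$ there is a projection $e\in R$ such that (1) $xe=x$ and (2) for $y\in R$, $xy=0$ implies $ey=0$. In a Rickart or weakly Rickart $*$-ring, the right projection $RP(x)$ of $x$ is the unique projection $e$ such that $xe=x$ and, for all $y$, $xy=0$ iff $ey=0$; the left projection is $LP(x)=RP(x^* )$, equivalently the projection $f$ with $fx=x$ and such that $yx=0$ iff $yf=0$. For a commutative $*$-ring $K$ with unity (the identity involution is permitted), $R$ is a $*$-algebra over $K$ if $R$ is a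 left $K$-module with $1a=a$, $\lambda(ab)=(\lambda a)b=a(\lambda b)$ and $(\lambda a)^*=\lambda^*a^*$ for all $\lambda\in K$, $a,b\in R$. *)

theory Defs
  imports "HOL-Algebra.Module"
begin

(* Rings without unity. They are carried by the record type of HOL-Algebra rings, whose field
   "one" is left unspecified and is never referred to for such a ring. *)
locale rng = abelian_group R for R :: "('a, 'm) ring_scheme" (structure) +
  assumes rng_m_closed: "\<lbrakk>x \<in> carrier R; y \<in> carrier R\<rbrakk> \<Longrightarrow> x \<otimes> y \<in> carrier R"
    and rng_m_assoc: "\<lbrakk>x \<in> carrier R; y \<in> carrier R; z \<in> carrier R\<rbrakk>
      \<Longrightarrow> (x \<otimes> y) \<otimes> z = x \<otimes> (y \<otimes> z)"
    and rng_l_distr: "\<lbrakk>x \<in> carrier R; y \<in> carrier R; z \<in> carrier R\<rbrakk>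
      \<Longrightarrow> (x \<oplus> y) \<otimes> z = x \<otimes> z \<oplus> y \<otimes> z"
    and rng_r_distr: "\<lbrakk>x \<in> carrier R; y \<in> carrier R; z \<in> carrier R\<rbrakk>
      \<Longrightarrow> z \<otimes> (x \<oplus> y) = z \<otimes> x \<oplus> z \<otimes> y"

(* The involution is a separate parameter rather than a record field, so that the same notion
   applies to rings and to modules in the sense of HOL-Algebra. *)
locale star_ring = rng R for R :: "('a, 'm) ring_scheme" (structure) +
  fixes star :: "'a \<Rightarrow> 'a"
  assumes star_closed: "x \<in> carrier R \<Longrightarrow> star x \<in> carrier R"
    and star_add: "\<lbrakk>x \<in> carrier R; y \<in> carrier R\<rbrakk> \<Longrightarrow> star (x \<oplus> y) = star x \<oplus> star y"
    and star_mult: "\<lbrakk>x \<in> carrier R; y \<in> carrier R\<rbrakk> \<Longrightarrow> star (x \<otimes> y) = star y \<otimes> star x"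
    and star_star: "x \<in> carrier R \<Longrightarrow> star (star x) = x"

definition projection :: "('a, 'm) ring_scheme \<Rightarrow> ('a \<Rightarrow> 'a) \<Rightarrow> 'a \<Rightarrow> bool" where
  "projection R star e \<longleftrightarrow> e \<in> carrier R \<and> star e = e \<and> e \<otimes>\<^bsub>R\<^esub> e = e"

definition proj_le :: "('a, 'm) ring_scheme \<Rightarrow> 'a \<Rightarrow> 'a \<Rightarrow> bool" where
  "proj_le R e f \<longleftrightarrow> e \<otimes>\<^bsub>R\<^esub> f = e"

definition right_annihilator :: "('a, 'm) ring_scheme \<Rightarrow> 'a set \<Rightarrow> 'a set" where
  "right_annihilator R X = {y \<in> carrier R. \<forall>x\<in>X. x \<otimes>\<^bsub>R\<^esub> y = \<zero>\<^bsub>R\<^esub>}"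

locale rickart_star_ring = star_ring R star
  for R :: "('a, 'm) ring_scheme" (structure) and star :: "'a \<Rightarrow> 'a" +
  assumes rickart: "x \<in> carrier R \<Longrightarrow>
    \<exists>e. projection R star e \<and> right_annihilator R {x} = {e \<otimes> y | y. y \<in> carrier R}"

locale weakly_rickart_star_ring = star_ring R star
  for R :: "('a, 'm) ring_scheme" (structure) and star :: "'a \<Rightarrow> 'a" +
  assumes weakly_rickart: "x \<in> carrier R \<Longrightarrow>
    \<exists>e. projection R star e \<and> x \<otimes> e = x \<and>
        (\<forall>y\<in>carrier R. x \<otimes> y = \<zero> \<longrightarrow> e \<otimes> y = \<zero>)"

definition is_RP :: "('a, 'm) ring_scheme \<Rightarrow> ('a \<Rightarrow> 'a) \<Rightarrow> 'a \<Rightarrow> 'a \<Rightarrow> bool" where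
  "is_RP R star x e \<longleftrightarrow> projection R star e \<and> x \<otimes>\<^bsub>R\<^esub> e = x \<and>
     (\<forall>y\<in>carrier R. x \<otimes>\<^bsub>R\<^esub> y = \<zero>\<^bsub>R\<^esub> \<longleftrightarrow> e \<otimes>\<^bsub>R\<^esub> y = \<zero>\<^bsub>R\<^esub>)"

definition RP :: "('a, 'm) ring_scheme \<Rightarrow> ('a \<Rightarrow> 'a) \<Rightarrow> 'a \<Rightarrow> 'a" where
  "RP R star x = (THE e. is_RP R star x e)"

definition LP :: "('a, 'm) ring_scheme \<Rightarrow> ('a \<Rightarrow> 'a) \<Rightarrow> 'a \<Rightarrow> 'a" where
  "LP R star x = RP R star (star x)"

(* The locale module supplies the commutative ring K with unity and the unital K-module R. *)
locale star_algebra = module K R + K_star: star_ring K starK + R_star: star_ring R starR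
  for K :: "('k, 'p) ring_scheme" and starK :: "'k \<Rightarrow> 'k"
    and R :: "('k, 'a, 'm) module_scheme" and starR :: "'a \<Rightarrow> 'a" +
  assumes smult_mult_left: "\<lbrakk>l \<in> carrier K; a \<in> carrier R; b \<in> carrier R\<rbrakk>
      \<Longrightarrow> l \<odot>\<^bsub>R\<^esub> (a \<otimes>\<^bsub>R\<^esub> b) = (l \<odot>\<^bsub>R\<^esub> a) \<otimes>\<^bsub>R\<^esub> b"
    and smult_mult_right: "\<lbrakk>l \<in> carrier K; a \<in> carrier R; b \<in> carrier R\<rbrakk>
      \<Longrightarrow> l \<odot>\<^bsub>R\<^esub> (a \<otimes>\<^bsub>R\<^esub> b) = a \<otimes>\<^bsub>R\<^esub> (l \<odot>\<^bsub>R\<^esub> b)"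
    and star_smult: "\<lbrakk>l \<in> carrier K; a \<in> carrier R\<rbrakk>
      \<Longrightarrow> starR (l \<odot>\<^bsub>R\<^esub> a) = starK l \<odot>\<^bsub>R\<^esub> starR a"

(* No condition on units: ring_hom of HOL-Algebra would relate the unspecified "one" fields. *)
definition star_ring_hom ::
  "('a, 'm) ring_scheme \<Rightarrow> ('a \<Rightarrow> 'a) \<Rightarrow> ('b, 'n) ring_scheme \<Rightarrow> ('b \<Rightarrow> 'b) \<Rightarrow> ('a \<Rightarrow> 'b) set" where
  "star_ring_hom R starR S starS = {h. h \<in> carrier R \<rightarrow> carrier S \<and>
     (\<forall>x\<in>carrier R. \<forall>y\<in>carrier R. h (x \<oplus>\<^bsub>R\<^esub> y) = h x \<oplus>\<^bsub>S\<^esub> h y \<and> h (x \<otimes>\<^bsub>R\<^esub> y) = h x \<otimes>\<^bsub>S\<^esub> h y) \<and>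
     (\<forall>x\<in>carrier R. h (starR x) = starS (h x))}"

(* Uniqueness behind the description operator in RP. *)
lemma (in star_ring) is_RP_unique:
  assumes x: "x \<in> carrier R" and e: "is_RP R star x e" and f: "is_RP R star x f"
  shows "e = f"
proof -
  have pe: "e \<in> carrier R" "star e = e" "e \<otimes> e = e" "x \<otimes> e = x"
    and pf: "f \<in> carrier R" "star f = f" "f \<otimes> f = f" "x \<otimes> f = x"
    using e f by (auto simp: is_RP_def projection_def)
  have key: "g \<otimes> h = g"
    if g: "is_RP R star x g" and h: "h \<in> carrier R" "h \<otimes> h = h" "x \<otimes> h = x" for g h
  proof -
    have gc: "g \<in> carrier R" and gg: "g \<otimes> g = g"
      using g by (auto simp: is_RP_def projection_def)
    have xg: "x \<otimes> g = x" using g by (simp add: is_RP_def)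
    have d: "g \<ominus> h \<in> carrier R" using gc h by simp
    have eq: "g = (g \<ominus> h) \<oplus> h"
      using gc h by (simp add: a_minus_def a_assoc l_neg)
    have "x = x \<otimes> (g \<ominus> h) \<oplus> x"
      using rng_r_distr[OF d h(1) x] eq h xg by simp
    moreover have xd: "x \<otimes> (g \<ominus> h) \<in> carrier R" using rng_m_closed[OF x d] .
    ultimately have "x \<otimes> (g \<ominus> h) = \<zero>"
      using x by (metis add.r_cancel_one')
    hence "g \<otimes> (g \<ominus> h) = \<zero>"
      using g d by (auto simp: is_RP_def)
    hence "g \<otimes> g = \<zero> \<oplus> g \<otimes> h"
      using rng_r_distr[OF d h(1) gc] eq by simp
    thus ?thesis using gg rng_m_closed[OF gc h(1)] by simp
  qed
  have "e \<otimes> f = e" using key[OF e pf(1,3,4)] .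
  moreover have "f \<otimes> e = f" using key[OF f pe(1,3,4)] .
  ultimately show ?thesis using star_mult[OF pe(1) pf(1)] pe(2) pf(2) by simp
qed

end

theory Submission
  imports Defs "HOL-Algebra.QuotRing"
begin

text \<open>
  Adjoin a unit to \<open>R\<close> by forming the unitization \<open>U = R \<times> K\<close>, where a pair \<open>(a, l)\<close> stands
  for \<open>a + l \<cdot> 1\<close> and acts on \<open>R\<close> by \<open>b \<mapsto> a b + l b\<close>. This action need not be faithful. Its kernel
  \<open>N\<close> is an ideal stable under the involution, and it meets \<open>R\<close> in zero because \<open>x = x RP(x)\<close>.
  Hence \<open>R\<close> embeds in \<open>S = U / N\<close> as an ideal, and an element of \<open>S\<close> is determined by its left
  action on \<open>R\<close>.

  This faithfulness reduces annihilators in \<open>S\<close> to computations in \<open>R\<close>: if a projection \<open>p\<close> of \<open>S\<close>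
  fixes exactly those \<open>b\<close> in \<open>R\<close> that \<open>s\<close> kills, then the right annihilator of \<open>s\<close> is \<open>p S\<close>
  (\<open>right_annihilator_cls\<close>), because \<open>s y = 0\<close> can be tested on the elements \<open>y b\<close>, which again lie
  in \<open>R\<close>. The same test shows that right projections computed in \<open>R\<close> remain right projections in
  \<open>S\<close> (\<open>RP_embed\<close>). It remains to find \<open>p\<close>.

  For \<open>s = a\<close> in \<open>R\<close>, take \<open>p = 1 - RP(a)\<close> (\<open>rickart_embed\<close>). For \<open>s = a + l \<cdot> 1\<close> with \<open>l \<noteq> 0\<close>,
  the projection can be found in \<open>R\<close> itself (\<open>act_zero_projection\<close>). Choose a projection \<open>f\<close> above
  both \<open>LP(a)\<close> and \<open>e\<^sub>l\<close>. If \<open>a y + l y = 0\<close>, then \<open>l y = - a y\<close> is fixed by \<open>f\<close>, so \<open>l\<close> kills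
  \<open>y - f y\<close>; the choice of \<open>e\<^sub>l\<close> then gives \<open>f (y - f y) = y - f y\<close>, that is \<open>y = f y\<close>. On such \<open>y\<close>
  the element \<open>s\<close> acts as \<open>c = a f + l f\<close>, which lies in \<open>R\<close>, and so \<open>p = f - RP(c)\<close> works.
\<close>

section \<open>Rings without unity\<close>

context rng
begin

lemma rng_r_null: assumes "x \<in> carrier R" shows "x \<otimes> \<zero> = \<zero>"
  using rng_r_distr[of \<zero> \<zero> x] rng_m_closed[of x \<zero>] assms by (simp add: add.r_cancel_one')

lemma rng_l_null: assumes "x \<in> carrier R" shows "\<zero> \<otimes> x = \<zero>"
  using rng_l_distr[of \<zero> \<zero> x] rng_m_closed[of \<zero> x] assms by (simp add: add.r_cancel_one')

lemma minus_unique_right: "\<lbrakk>x \<in> carrier R; y \<in> carrier R; z \<in> carrier R; z = x \<oplus> y\<rbrakk> \<Longrightarrow> x = z \<ominus> y"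
  by (simp add: a_minus_def a_assoc r_neg)

lemma minus_plus_cancel: "\<lbrakk>x \<in> carrier R; y \<in> carrier R\<rbrakk> \<Longrightarrow> (x \<ominus> y) \<oplus> y = x"
  by (simp add: a_minus_def a_assoc l_neg)

lemma minus_self: "x \<in> carrier R \<Longrightarrow> x \<ominus> x = \<zero>"
  by (simp add: a_minus_def r_neg)

lemma minus_eq_zero_iff:
  assumes "x \<in> carrier R" "y \<in> carrier R" shows "x \<ominus> y = \<zero> \<longleftrightarrow> x = y"
  using assms minus_plus_cancel[of x y] minus_self by auto

lemma minus_zero: "x \<in> carrier R \<Longrightarrow> x \<ominus> \<zero> = x"
  by (simp add: a_minus_def)

lemma rng_r_diff:
  assumes x: "x \<in> carrier R" and y: "y \<in> carrier R" and z: "z \<in> carrier R"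
  shows "z \<otimes> (x \<ominus> y) = z \<otimes> x \<ominus> z \<otimes> y"
  using rng_r_distr[of "x \<ominus> y" y z] minus_plus_cancel[OF x y] assms
  by (intro minus_unique_right) (auto simp: rng_m_closed)

lemma rng_l_diff:
  assumes x: "x \<in> carrier R" and y: "y \<in> carrier R" and z: "z \<in> carrier R"
  shows "(x \<ominus> y) \<otimes> z = x \<otimes> z \<ominus> y \<otimes> z"
  using rng_l_distr[of "x \<ominus> y" y z] minus_plus_cancel[OF x y] assms
  by (intro minus_unique_right) (auto simp: rng_m_closed)

end

section \<open>Projections in weakly Rickart rings with involution\<close>

context star_ring
begin

lemma star_zero: "star \<zero> = \<zero>"
  using star_add[of \<zero> \<zero>] star_closed[of \<zero>] by (simp add: add.r_cancel_one')

lemma star_diff: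
  assumes x: "x \<in> carrier R" and y: "y \<in> carrier R"
  shows "star (x \<ominus> y) = star x \<ominus> star y"
  using star_add[of "x \<ominus> y" y] minus_plus_cancel[OF x y] assms
  by (intro minus_unique_right) (auto simp: star_closed)

text \<open>Each equation is the adjoint of the other.\<close>

lemma projection_absorb_commute:
  assumes "projection R star e" "projection R star f"
  shows "e \<otimes> f = e \<longleftrightarrow> f \<otimes> e = e"
  using assms star_mult unfolding projection_def by metis

lemma projection_diff:
  assumes f: "projection R star f" and g: "projection R star g" and gf: "g \<otimes> f = g"
  shows "projection R star (f \<ominus> g)"
proof -
  have c: "f \<in> carrier R" "g \<in> carrier R" "star f = f" "star g = g" "f \<otimes> f = f" "g \<otimes> g = g"
    using f g by (auto simp: projection_def)
  have "f \<otimes> g = g" using projection_absorb_commute[OF g f] gf by simp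
  hence "(f \<ominus> g) \<otimes> (f \<ominus> g) = f \<ominus> g"
    using c gf by (simp add: rng_l_diff rng_r_diff minus_self minus_zero)
  thus ?thesis using c by (simp add: projection_def star_diff)
qed

text \<open>If \<open>x f = x\<close>, then \<open>x\<close> kills \<open>e - f\<close>, hence so does its right projection \<open>e\<close>.\<close>

lemma is_RP_least:
  assumes x: "x \<in> carrier R" and e: "is_RP R star x e" and f: "f \<in> carrier R" and xf: "x \<otimes> f = x"
  shows "e \<otimes> f = e"
proof -
  have c: "e \<in> carrier R" "e \<otimes> e = e" "x \<otimes> e = x"
    using e by (auto simp: is_RP_def projection_def)
  have "x \<otimes> (e \<ominus> f) = \<zero>" using x f xf c by (simp add: rng_r_diff minus_self)
  hence "e \<otimes> (e \<ominus> f) = \<zero>" using e c f by (auto simp: is_RP_def)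
  thus ?thesis using c f by (simp add: rng_r_diff minus_eq_zero_iff rng_m_closed)
qed

end

context weakly_rickart_star_ring
begin

lemma is_RP_RP:
  assumes x: "x \<in> carrier R"
  shows "is_RP R star x (RP R star x)"
proof -
  obtain e where e: "projection R star e" "x \<otimes> e = x" "\<forall>y\<in>carrier R. x \<otimes> y = \<zero> \<longrightarrow> e \<otimes> y = \<zero>"
    using weakly_rickart[OF x] by blast
  have ec: "e \<in> carrier R" using e(1) by (simp add: projection_def)
  have "x \<otimes> y = \<zero>" if y: "y \<in> carrier R" and ey: "e \<otimes> y = \<zero>" for y
    using rng_m_assoc[OF x ec y] e(2) ey rng_r_null[OF x] by simp
  hence "is_RP R star x e" using e by (auto simp: is_RP_def)
  thus ?thesis unfolding RP_def using is_RP_unique[OF x] by (metis theI)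
qed

lemma projection_RP: "x \<in> carrier R \<Longrightarrow> projection R star (RP R star x)"
  and mult_RP: "x \<in> carrier R \<Longrightarrow> x \<otimes> RP R star x = x"
  and RP_mult_zero_iff:
    "\<lbrakk>x \<in> carrier R; y \<in> carrier R\<rbrakk> \<Longrightarrow> RP R star x \<otimes> y = \<zero> \<longleftrightarrow> x \<otimes> y = \<zero>"
  using is_RP_RP by (auto simp: is_RP_def)

lemma RP_closed: "x \<in> carrier R \<Longrightarrow> RP R star x \<in> carrier R"
  using projection_RP by (simp add: projection_def)

lemma projection_LP: "x \<in> carrier R \<Longrightarrow> projection R star (LP R star x)"
  unfolding LP_def by (simp add: projection_RP star_closed)

lemma LP_closed: "x \<in> carrier R \<Longrightarrow> LP R star x \<in> carrier R"
  using projection_LP by (simp add: projection_def)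

lemma LP_mult:
  assumes x: "x \<in> carrier R" shows "LP R star x \<otimes> x = x"
  using mult_RP[OF star_closed[OF x]] star_mult[OF star_closed[OF x] LP_closed[OF x]]
    projection_LP[OF x] x
  by (simp add: LP_def star_star projection_def)

lemma left_mult_eq_if_LP_le:
  assumes x: "x \<in> carrier R" and f: "projection R star f" and le: "f \<otimes> LP R star x = LP R star x"
  shows "f \<otimes> x = x"
  using rng_m_assoc[of f "LP R star x" x] LP_mult[OF x] LP_closed[OF x] f x le
  by (simp add: projection_def)

lemma zero_if_right_mult_zero:
  assumes x: "x \<in> carrier R" and z: "\<And>y. y \<in> carrier R \<Longrightarrow> x \<otimes> y = \<zero>"
  shows "x = \<zero>"
  using mult_RP[OF x] z[OF RP_closed[OF x]] by simp

lemma zero_if_left_mult_zero: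
  assumes x: "x \<in> carrier R" and z: "\<And>y. y \<in> carrier R \<Longrightarrow> y \<otimes> x = \<zero>"
  shows "x = \<zero>"
  using LP_mult[OF x] z[OF LP_closed[OF x]] by simp

text \<open>
  The upper bound is \<open>e + RP(d - d e)\<close>. The element \<open>d - d e\<close> is killed by \<open>e\<close> on the right, so its
  right projection is orthogonal to \<open>e\<close> and the sum is again a projection.
\<close>

lemma projection_upper_bound:
  assumes d: "projection R star d" and e: "projection R star e"
  obtains f where "projection R star f" "f \<otimes> d = d" "f \<otimes> e = e"
proof -
  have c: "d \<in> carrier R" "e \<in> carrier R" "star d = d" "star e = e" "d \<otimes> d = d" "e \<otimes> e = e"
    using d e by (auto simp: projection_def)
  define x where "x = d \<ominus> d \<otimes> e"
  have x: "x \<in> carrier R" using c by (simp add: x_def rng_m_closed)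
  define g where "g = RP R star x"
  have g: "projection R star g" and xg: "x \<otimes> g = x"
    using x by (auto simp: g_def projection_RP mult_RP)
  have gc: "g \<in> carrier R" "star g = g" "g \<otimes> g = g" using g by (auto simp: projection_def)
  have "x \<otimes> e = \<zero>" using c by (simp add: x_def rng_l_diff rng_m_closed rng_m_assoc minus_self)
  hence ge: "g \<otimes> e = \<zero>" using RP_mult_zero_iff[OF x] c by (simp add: g_def)
  hence eg: "e \<otimes> g = \<zero>" using star_mult[of g e] c gc star_zero by simp
  define f where "f = e \<oplus> g"
  have f: "projection R star f"
    using c gc ge eg by (simp add: f_def projection_def star_add rng_l_distr rng_r_distr)
  have "d \<otimes> g = x"
    using xg c gc eg by (simp add: x_def rng_l_diff rng_m_closed rng_m_assoc rng_r_null minus_zero)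
  hence "d \<otimes> f = d"
    using c gc minus_plus_cancel[of d "d \<otimes> e"]
    by (simp add: f_def rng_r_distr x_def rng_m_closed a_comm)
  moreover have "e \<otimes> f = e" using c gc eg by (simp add: f_def rng_r_distr)
  ultimately show thesis
    using that[OF f] projection_absorb_commute[OF d f] projection_absorb_commute[OF e f] by simp
qed

end

section \<open>The unitization and its action\<close>

definition unitization_act :: "('k, 'a, 'm) module_scheme \<Rightarrow> 'a \<times> 'k \<Rightarrow> 'a \<Rightarrow> 'a" where
  "unitization_act R u b = fst u \<otimes>\<^bsub>R\<^esub> b \<oplus>\<^bsub>R\<^esub> snd u \<odot>\<^bsub>R\<^esub> b"

text \<open>The product of \<open>(a, l)\<close> and \<open>(b, m)\<close> is that of \<open>a + l \<cdot> 1\<close> and \<open>b + m \<cdot> 1\<close>.\<close>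

definition unitization :: "('k, 'p) ring_scheme \<Rightarrow> ('k, 'a, 'm) module_scheme \<Rightarrow> ('a \<times> 'k) ring" where
  "unitization K R =
    \<lparr>carrier = carrier R \<times> carrier K,
     mult = \<lambda>u v. (unitization_act R u (fst v) \<oplus>\<^bsub>R\<^esub> snd v \<odot>\<^bsub>R\<^esub> fst u, snd u \<otimes>\<^bsub>K\<^esub> snd v),
     one = (\<zero>\<^bsub>R\<^esub>, \<one>\<^bsub>K\<^esub>),
     zero = (\<zero>\<^bsub>R\<^esub>, \<zero>\<^bsub>K\<^esub>),
     add = \<lambda>u v. (fst u \<oplus>\<^bsub>R\<^esub> fst v, snd u \<oplus>\<^bsub>K\<^esub> snd v)\<rparr>"

definition unitization_star :: "('k \<Rightarrow> 'k) \<Rightarrow> ('a \<Rightarrow> 'a) \<Rightarrow> 'a \<times> 'k \<Rightarrow> 'a \<times> 'k" where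
  "unitization_star starK starR u = (starR (fst u), starK (snd u))"

definition act_kernel :: "('k, 'p) ring_scheme \<Rightarrow> ('k, 'a, 'm) module_scheme \<Rightarrow> ('a \<times> 'k) set" where
  "act_kernel K R = {u \<in> carrier R \<times> carrier K. \<forall>b\<in>carrier R. unitization_act R u b = \<zero>\<^bsub>R\<^esub>}"

context star_algebra
begin

lemmas smult_simps = smult_l_distr smult_r_distr smult_assoc1
  R_star.rng_m_closed R_star.rng_l_distr R_star.rng_r_distr R_star.rng_m_assoc
  smult_mult_left[symmetric] smult_mult_right[symmetric]

lemma smult_commute:
  "\<lbrakk>l \<in> carrier K; m \<in> carrier K; x \<in> carrier R\<rbrakk> \<Longrightarrow> l \<odot>\<^bsub>R\<^esub> (m \<odot>\<^bsub>R\<^esub> x) = m \<odot>\<^bsub>R\<^esub> (l \<odot>\<^bsub>R\<^esub> x)"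
  by (simp add: smult_assoc1[symmetric] R.m_comm)

lemma ring_unitization: "ring (unitization K R)"
proof (intro ringI abelian_groupI monoidI)
  fix u assume "u \<in> carrier (unitization K R)"
  then show "\<exists>v\<in>carrier (unitization K R). v \<oplus>\<^bsub>unitization K R\<^esub> u = \<zero>\<^bsub>unitization K R\<^esub>"
    by (intro bexI[of _ "(\<ominus>\<^bsub>R\<^esub> fst u, \<ominus>\<^bsub>K\<^esub> snd u)"]) (auto simp: unitization_def R.l_neg M.l_neg)
qed (auto simp: unitization_def unitization_act_def smult_simps R_star.rng_r_null R_star.rng_l_null
       M.a_ac R.a_ac R.m_ac R.l_distr R.r_distr smult_commute)

lemma act_closed:
  "\<lbrakk>u \<in> carrier R \<times> carrier K; b \<in> carrier R\<rbrakk> \<Longrightarrow> unitization_act R u b \<in> carrier R"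
  by (auto simp: unitization_act_def R_star.rng_m_closed)

lemma act_add:
  "\<lbrakk>u \<in> carrier R \<times> carrier K; v \<in> carrier R \<times> carrier K; b \<in> carrier R\<rbrakk> \<Longrightarrow>
   unitization_act R (u \<oplus>\<^bsub>unitization K R\<^esub> v) b = unitization_act R u b \<oplus>\<^bsub>R\<^esub> unitization_act R v b"
  by (auto simp: unitization_act_def unitization_def smult_simps M.a_ac)

lemma act_mult:
  "\<lbrakk>u \<in> carrier R \<times> carrier K; v \<in> carrier R \<times> carrier K; b \<in> carrier R\<rbrakk> \<Longrightarrow>
   unitization_act R (u \<otimes>\<^bsub>unitization K R\<^esub> v) b = unitization_act R u (unitization_act R v b)"
  by (auto simp: unitization_act_def unitization_def smult_simps M.a_ac)

lemma act_zero: "u \<in> carrier R \<times> carrier K \<Longrightarrow> unitization_act R u \<zero>\<^bsub>R\<^esub> = \<zero>\<^bsub>R\<^esub>"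
  by (auto simp: unitization_act_def R_star.rng_r_null)

text \<open>
  Writing \<open>u b\<close> for the action, this is \<open>c (u\<^sup>* b) = (b\<^sup>* (u c\<^sup>*))\<^sup>*\<close>. It moves the involution off \<open>u\<close> and is what
  makes the kernel of the action stable under the involution.
\<close>

lemma act_adjoint:
  assumes u: "u \<in> carrier R \<times> carrier K" and b: "b \<in> carrier R" and c: "c \<in> carrier R"
  shows "c \<otimes>\<^bsub>R\<^esub> unitization_act R (unitization_star starK starR u) b =
         starR (starR b \<otimes>\<^bsub>R\<^esub> unitization_act R u (starR c))"
  using assms
  by (auto simp: unitization_act_def unitization_star_def R_star.star_mult R_star.star_add star_smult
      R_star.star_closed R_star.star_star K_star.star_closed smult_simps)

lemma star_ring_unitization: "star_ring (unitization K R) (unitization_star starK starR)"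
proof -
  interpret U: ring "unitization K R" by (rule ring_unitization)
  show ?thesis
    by unfold_locales
      (auto simp: U.m_assoc U.l_distr U.r_distr unitization_star_def R_star.star_closed
        K_star.star_closed,
       auto simp: unitization_def unitization_act_def unitization_star_def R_star.star_mult
        R_star.star_add star_smult R_star.star_closed R_star.star_star K_star.star_closed
        K_star.star_star K_star.star_add K_star.star_mult smult_simps M.a_ac R.m_ac)
qed

end


section \<open>Zeros of the action\<close>

locale weakly_rickart_star_algebra = star_algebra K starK R starR +
    weakly_rickart_star_ring R starR
  for K :: "('k, 'p) ring_scheme" and starK :: "'k \<Rightarrow> 'k"
    and R :: "('k, 'a, 'm) module_scheme" and starR :: "'a \<Rightarrow> 'a"
begin

text \<open>
  The bound \<open>e\<close> controls the elements killed by \<open>l\<close>, and this is enough to confine the zeros \<open>y\<close>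
  of the action of \<open>(a, l)\<close> to \<open>f R\<close> for a projection \<open>f\<close> in \<open>R\<close>. There the action is left
  multiplication by the element \<open>c\<close> of \<open>R\<close>, whose right projection \<open>g\<close> is available; the zeros
  are then the elements fixed by \<open>f - g\<close>.
\<close>

lemma act_zero_projection:
  assumes a: "a \<in> carrier R" and l: "l \<in> carrier K" and e: "projection R starR e"
    and bound: "\<forall>x\<in>carrier R. l \<odot>\<^bsub>R\<^esub> x = \<zero>\<^bsub>R\<^esub> \<longrightarrow> proj_le R (LP R starR x) e"
  shows "\<exists>h. projection R starR h \<and>
    (\<forall>y\<in>carrier R. unitization_act R (a, l) y = \<zero>\<^bsub>R\<^esub> \<longleftrightarrow> h \<otimes>\<^bsub>R\<^esub> y = y)"
proof -
  obtain f where f: "projection R starR f" and fLP: "f \<otimes>\<^bsub>R\<^esub> LP R starR a = LP R starR a"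
    and fe: "f \<otimes>\<^bsub>R\<^esub> e = e"
    using projection_upper_bound[OF projection_LP[OF a] e] .
  have fc: "f \<in> carrier R" "f \<otimes>\<^bsub>R\<^esub> f = f" and ec: "e \<in> carrier R"
    using f e by (auto simp: projection_def)
  have fa: "f \<otimes>\<^bsub>R\<^esub> a = a" using left_mult_eq_if_LP_le[OF a f fLP] .
  have kernel: "f \<otimes>\<^bsub>R\<^esub> x = x" if x: "x \<in> carrier R" and lx: "l \<odot>\<^bsub>R\<^esub> x = \<zero>\<^bsub>R\<^esub>" for x
  proof -
    have "e \<otimes>\<^bsub>R\<^esub> LP R starR x = LP R starR x"
      using bound x lx R_star.projection_absorb_commute[OF projection_LP[OF x] e]
      by (simp add: proj_le_def)
    hence "f \<otimes>\<^bsub>R\<^esub> LP R starR x = LP R starR x"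
      using R_star.rng_m_assoc[OF fc(1) ec LP_closed[OF x]] fe by simp
    thus ?thesis by (rule left_mult_eq_if_LP_le[OF x f])
  qed
  \<comment> \<open>The element \<open>(a + l \<cdot> 1) f\<close> of the ideal \<open>R\<close>.\<close>
  define c where "c = unitization_act R (a, l) f"
  have c: "c \<in> carrier R" using a l fc by (simp add: c_def act_closed)
  have c_mult: "c \<otimes>\<^bsub>R\<^esub> y = unitization_act R (a, l) (f \<otimes>\<^bsub>R\<^esub> y)" if "y \<in> carrier R" for y
    using a l fc that by (simp add: c_def unitization_act_def smult_simps)
  define g where "g = RP R starR c"
  have g: "projection R starR g" using c by (simp add: g_def projection_RP)
  hence gc: "g \<in> carrier R" "g \<otimes>\<^bsub>R\<^esub> g = g" by (auto simp: projection_def)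
  have "c \<otimes>\<^bsub>R\<^esub> f = c" using c_mult[OF fc(1)] fc by (simp add: c_def)
  hence gf: "g \<otimes>\<^bsub>R\<^esub> f = g" using R_star.is_RP_least[OF c is_RP_RP[OF c] fc(1)] by (simp add: g_def)
  hence fg: "f \<otimes>\<^bsub>R\<^esub> g = g" using R_star.projection_absorb_commute[OF g f] by simp
  define h where "h = f \<ominus>\<^bsub>R\<^esub> g"
  have hc: "h \<in> carrier R" using fc gc by (simp add: h_def)
  have "unitization_act R (a, l) y = \<zero>\<^bsub>R\<^esub> \<longleftrightarrow> h \<otimes>\<^bsub>R\<^esub> y = y" if y: "y \<in> carrier R" for y
  proof
    assume 0: "unitization_act R (a, l) y = \<zero>\<^bsub>R\<^esub>"
    have ay: "a \<otimes>\<^bsub>R\<^esub> y \<in> carrier R" and ly: "l \<odot>\<^bsub>R\<^esub> y \<in> carrier R"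
      and fy: "f \<otimes>\<^bsub>R\<^esub> y \<in> carrier R"
      using a l fc y by (auto simp: R_star.rng_m_closed)
    have "f \<otimes>\<^bsub>R\<^esub> unitization_act R (a, l) y = a \<otimes>\<^bsub>R\<^esub> y \<oplus>\<^bsub>R\<^esub> f \<otimes>\<^bsub>R\<^esub> (l \<odot>\<^bsub>R\<^esub> y)"
      using R_star.rng_r_distr[OF ay ly fc(1)] R_star.rng_m_assoc[OF fc(1) a y] fa
      by (simp add: unitization_act_def)
    hence "a \<otimes>\<^bsub>R\<^esub> y \<oplus>\<^bsub>R\<^esub> f \<otimes>\<^bsub>R\<^esub> (l \<odot>\<^bsub>R\<^esub> y) = a \<otimes>\<^bsub>R\<^esub> y \<oplus>\<^bsub>R\<^esub> l \<odot>\<^bsub>R\<^esub> y"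
      using 0 fc by (simp add: unitization_act_def R_star.rng_r_null)
    hence fly: "f \<otimes>\<^bsub>R\<^esub> (l \<odot>\<^bsub>R\<^esub> y) = l \<odot>\<^bsub>R\<^esub> y"
      using ay ly fc by (simp add: R_star.rng_m_closed)
    \<comment> \<open>Since \<open>l y\<close> is fixed by \<open>f\<close>, the part of \<open>y\<close> outside \<open>f R\<close> is killed by \<open>l\<close>; but \<open>f\<close> fixes
      everything killed by \<open>l\<close>, so this part vanishes.\<close>
    define d where "d = y \<ominus>\<^bsub>R\<^esub> f \<otimes>\<^bsub>R\<^esub> y"
    have d: "d \<in> carrier R" using y fy by (simp add: d_def)
    have "l \<odot>\<^bsub>R\<^esub> y = l \<odot>\<^bsub>R\<^esub> d \<oplus>\<^bsub>R\<^esub> l \<odot>\<^bsub>R\<^esub> (f \<otimes>\<^bsub>R\<^esub> y)"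
      using smult_r_distr[OF l d fy] R_star.minus_plus_cancel[OF y fy] by (simp add: d_def)
    hence "l \<odot>\<^bsub>R\<^esub> d = \<zero>\<^bsub>R\<^esub>"
      using fly l fc y d by (simp add: smult_mult_right)
    hence "f \<otimes>\<^bsub>R\<^esub> d = d" by (rule kernel[OF d])
    hence "d = \<zero>\<^bsub>R\<^esub>"
      using y fc fy R_star.rng_m_assoc[OF fc(1) fc(1) y]
      by (simp add: d_def R_star.rng_r_diff R_star.minus_self)
    hence "f \<otimes>\<^bsub>R\<^esub> y = y" using y fy by (simp add: d_def R_star.minus_eq_zero_iff)
    moreover from this have "g \<otimes>\<^bsub>R\<^esub> y = \<zero>\<^bsub>R\<^esub>"
      using c_mult[OF y] 0 RP_mult_zero_iff[OF c y] by (simp add: g_def)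
    ultimately show "h \<otimes>\<^bsub>R\<^esub> y = y"
      using fc gc y by (simp add: h_def R_star.rng_l_diff R_star.minus_zero)
  next
    assume hy: "h \<otimes>\<^bsub>R\<^esub> y = y"
    have "f \<otimes>\<^bsub>R\<^esub> h = h" "g \<otimes>\<^bsub>R\<^esub> h = \<zero>\<^bsub>R\<^esub>"
      using fc gc fg gf by (auto simp: h_def R_star.rng_r_diff R_star.minus_self)
    hence fy: "f \<otimes>\<^bsub>R\<^esub> y = y" and gy: "g \<otimes>\<^bsub>R\<^esub> y = \<zero>\<^bsub>R\<^esub>"
      using R_star.rng_m_assoc[OF fc(1) hc y] R_star.rng_m_assoc[OF gc(1) hc y] hy y
      by (simp_all add: R_star.rng_l_null)
    show "unitization_act R (a, l) y = \<zero>\<^bsub>R\<^esub>"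
      using gy c_mult[OF y] fy RP_mult_zero_iff[OF c y] by (simp add: g_def)
  qed
  moreover have "projection R starR h"
    unfolding h_def by (rule R_star.projection_diff[OF f g gf])
  ultimately show ?thesis by blast
qed

section \<open>The quotient by the kernel of the action\<close>

text \<open>
  The ideal \<open>N\<close> is stable under the involution of \<open>U\<close>, so the image of a coset under that involution
  is a coset, and taking images is the induced involution of the quotient.
\<close>

abbreviation "U \<equiv> unitization K R"
abbreviation "N \<equiv> act_kernel K R"
abbreviation "S \<equiv> U Quot N"
abbreviation "starU \<equiv> unitization_star starK starR"
abbreviation "starS X \<equiv> starU ` X"
abbreviation "cls u \<equiv> N +>\<^bsub>U\<^esub> u"
abbreviation "\<iota> x \<equiv> cls (x, \<zero>\<^bsub>K\<^esub>)"

lemma carrier_U: "carrier U = carrier R \<times> carrier K"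
  by (simp add: unitization_def)

lemma starU_closed: "u \<in> carrier U \<Longrightarrow> starU u \<in> carrier U"
  using star_ring.star_closed[OF star_ring_unitization] .

lemma ideal_act_kernel: "ideal N U"
proof (rule idealI)
  interpret U: ring U by (rule ring_unitization)
  show "ring U" by (rule ring_unitization)
  have act_U_zero: "unitization_act R \<zero>\<^bsub>U\<^esub> b = \<zero>\<^bsub>R\<^esub>" if "b \<in> carrier R" for b
    using that by (simp add: unitization_def unitization_act_def R_star.rng_l_null)
  show "subgroup N (add_monoid U)"
  proof (rule U.add.subgroupI)
    show "N \<subseteq> carrier U" by (auto simp: act_kernel_def carrier_U)
    show "N \<noteq> {}"
    proof -
      have "\<zero>\<^bsub>U\<^esub> \<in> N" using act_U_zero U.zero_closed by (simp add: act_kernel_def carrier_U)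
      thus ?thesis by blast
    qed
    fix u assume u: "u \<in> N"
    hence uU: "u \<in> carrier U" by (simp add: act_kernel_def carrier_U)
    have "unitization_act R (\<ominus>\<^bsub>U\<^esub> u) b = \<zero>\<^bsub>R\<^esub>" if b: "b \<in> carrier R" for b
      using act_add[of u "\<ominus>\<^bsub>U\<^esub> u" b] uU u b U.r_neg[OF uU] act_U_zero[OF b]
        U.a_inv_closed[OF uU] act_closed[of "\<ominus>\<^bsub>U\<^esub> u" b]
      by (simp add: act_kernel_def carrier_U)
    thus "\<ominus>\<^bsub>U\<^esub> u \<in> N" using U.a_inv_closed[OF uU] by (simp add: act_kernel_def carrier_U)
    fix v assume v: "v \<in> N"
    show "u \<oplus>\<^bsub>U\<^esub> v \<in> N"
      using u v U.a_closed[of u v] by (simp add: act_kernel_def carrier_U act_add)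
  qed
  fix u v assume u: "u \<in> N" and v: "v \<in> carrier U"
  show "v \<otimes>\<^bsub>U\<^esub> u \<in> N"
    using u v U.m_closed[of v u] by (simp add: act_kernel_def carrier_U act_mult act_zero)
  show "u \<otimes>\<^bsub>U\<^esub> v \<in> N"
    using u v U.m_closed[of u v] by (simp add: act_kernel_def carrier_U act_mult act_closed)
qed

text \<open>
  If \<open>u\<close> acts as zero, the adjoint identity shows that \<open>R\<close> annihilates every \<open>u\<^sup>* b\<close> from the left,
  and only zero is annihilated in this way, because \<open>LP(x) x = x\<close>.
\<close>

lemma star_act_kernel: assumes u: "u \<in> N" shows "starU u \<in> N"
proof -
  have uU: "u \<in> carrier R \<times> carrier K" using u by (simp add: act_kernel_def)
  have sU: "starU u \<in> carrier R \<times> carrier K" using starU_closed uU by (simp add: carrier_U)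
  have "unitization_act R (starU u) b = \<zero>\<^bsub>R\<^esub>" if b: "b \<in> carrier R" for b
  proof (rule zero_if_left_mult_zero[OF act_closed[OF sU b]])
    fix c assume c: "c \<in> carrier R"
    show "c \<otimes>\<^bsub>R\<^esub> unitization_act R (starU u) b = \<zero>\<^bsub>R\<^esub>"
      using act_adjoint[OF uU b c] u b c
      by (simp add: act_kernel_def R_star.star_closed R_star.rng_r_null R_star.star_zero)
  qed
  thus ?thesis using sU by (simp add: act_kernel_def)
qed

text \<open>The quotient acts faithfully on \<open>R\<close>, so identities in \<open>S\<close> can be verified in \<open>R\<close>.\<close>

lemma cls_eq_iff:
  assumes u: "u \<in> carrier U" and v: "v \<in> carrier U"
  shows "cls u = cls v \<longleftrightarrow> (\<forall>b\<in>carrier R. unitization_act R u b = unitization_act R v b)"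
proof -
  interpret U: ring U by (rule ring_unitization)
  interpret N: ideal N U by (rule ideal_act_kernel)
  have "unitization_act R (u \<ominus>\<^bsub>U\<^esub> v) b = unitization_act R u b \<ominus>\<^bsub>R\<^esub> unitization_act R v b"
    if b: "b \<in> carrier R" for b
  proof -
    have "(u \<ominus>\<^bsub>U\<^esub> v) \<oplus>\<^bsub>U\<^esub> v = u"
      using u v by (simp add: a_minus_def U.a_assoc U.l_neg)
    hence "unitization_act R u b = unitization_act R (u \<ominus>\<^bsub>U\<^esub> v) b \<oplus>\<^bsub>R\<^esub> unitization_act R v b"
      using act_add[of "u \<ominus>\<^bsub>U\<^esub> v" v b] u v b U.minus_closed[OF u v] by (simp add: carrier_U)
    thus ?thesis using act_closed u v b U.minus_closed[OF u v]
      by (intro R_star.minus_unique_right) (auto simp: carrier_U)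
  qed
  hence "u \<ominus>\<^bsub>U\<^esub> v \<in> N \<longleftrightarrow> (\<forall>b\<in>carrier R. unitization_act R u b = unitization_act R v b)"
    using U.minus_closed[OF u v] u v
    by (simp add: act_kernel_def carrier_U R_star.minus_eq_zero_iff act_closed)
  thus ?thesis using U.quotient_eq_iff_same_a_r_cos[OF ideal_act_kernel u v] by simp
qed

lemma carrier_quotient: "carrier S = cls ` carrier U"
  by (auto simp: FactRing_def A_RCOSETS_def' a_r_coset_def')

lemma cls_hom:
  assumes "u \<in> carrier U" "v \<in> carrier U"
  shows "cls (u \<oplus>\<^bsub>U\<^esub> v) = cls u \<oplus>\<^bsub>S\<^esub> cls v" "cls (u \<otimes>\<^bsub>U\<^esub> v) = cls u \<otimes>\<^bsub>S\<^esub> cls v"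
  using assms ideal.rcos_ring_hom[OF ideal_act_kernel]
  by (simp_all only: ring_hom_add ring_hom_mult)

lemma ring_quotient: "ring S"
  by (rule ideal.quotient_is_ring[OF ideal_act_kernel])

lemma cls_mult_eq_zero_iff:
  assumes u: "u \<in> carrier U" and v: "v \<in> carrier U"
  shows "cls u \<otimes>\<^bsub>S\<^esub> cls v = \<zero>\<^bsub>S\<^esub> \<longleftrightarrow>
    (\<forall>b\<in>carrier R. unitization_act R u (unitization_act R v b) = \<zero>\<^bsub>R\<^esub>)"
proof -
  interpret U: ring U by (rule ring_unitization)
  have "\<zero>\<^bsub>S\<^esub> = cls \<zero>\<^bsub>U\<^esub>"
    using ring_hom_zero[OF ideal.rcos_ring_hom[OF ideal_act_kernel] ring_unitization ring_quotient] by simp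
  moreover have "unitization_act R \<zero>\<^bsub>U\<^esub> b = \<zero>\<^bsub>R\<^esub>" if "b \<in> carrier R" for b
    using that by (simp add: unitization_def unitization_act_def R_star.rng_l_null)
  ultimately show ?thesis
    using u v by (simp add: cls_hom(2)[symmetric] cls_eq_iff act_mult flip: carrier_U)
qed

text \<open>
  One inclusion is additivity of the involution together with stability of \<open>N\<close>; applied to the
  adjoint of \<open>u\<close>, it also gives the other one.
\<close>

lemma star_cls:
  assumes u: "u \<in> carrier U" shows "starS (cls u) = cls (starU u)"
proof -
  interpret US: star_ring U starU by (rule star_ring_unitization)
  have N: "n \<in> N \<Longrightarrow> n \<in> carrier U" for n by (simp add: act_kernel_def carrier_U)
  have sub: "starS (cls v) \<subseteq> cls (starU v)" if v: "v \<in> carrier U" for v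
  proof
    fix x assume "x \<in> starS (cls v)"
    then obtain n where n: "n \<in> N" and "x = starU (n \<oplus>\<^bsub>U\<^esub> v)" by (auto simp: a_r_coset_def')
    hence "x = starU n \<oplus>\<^bsub>U\<^esub> starU v" using N v by (simp only: US.star_add)
    thus "x \<in> cls (starU v)" using star_act_kernel[OF n] unfolding a_r_coset_def' by blast
  qed
  have "x \<in> starS (cls u)" if x: "x \<in> cls (starU u)" for x
  proof -
    have "starU x \<in> cls u"
      using sub[OF starU_closed[OF u]] x by (auto simp: US.star_star[OF u])
    moreover have "x \<in> carrier U"
      using x N starU_closed[OF u] by (auto simp: a_r_coset_def')
    ultimately show ?thesis using US.star_star by (metis imageI)
  qed
  thus ?thesis using sub[OF u] by blast
qed

lemma star_ring_quotient: "star_ring S starS"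
proof -
  interpret U: ring U by (rule ring_unitization)
  interpret US: star_ring U starU by (rule star_ring_unitization)
  interpret S: ring S by (rule ring_quotient)
  have mem: "cls u \<in> carrier S" if "u \<in> carrier U" for u
    using that unfolding carrier_quotient by (rule imageI)
  show ?thesis
  proof (unfold_locales, goal_cases)
    \<comment> \<open>Goals 5 to 8 are the axioms of the involution, the others come from the ring structure.\<close>
    case (5 X)
    then obtain u where u: "u \<in> carrier U" "X = cls u" unfolding carrier_quotient by blast
    thus ?case by (simp only: star_cls mem starU_closed)
  next
    case (6 X Y)
    then obtain u v where "u \<in> carrier U" "X = cls u" "v \<in> carrier U" "Y = cls v"
      unfolding carrier_quotient by blast
    thus ?case by (simp only: star_cls cls_hom[symmetric] U.a_closed US.star_add starU_closed)
  next
    case (7 X Y)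
    then obtain u v where "u \<in> carrier U" "X = cls u" "v \<in> carrier U" "Y = cls v"
      unfolding carrier_quotient by blast
    thus ?case by (simp only: star_cls cls_hom[symmetric] U.m_closed US.star_mult starU_closed)
  next
    case (8 X)
    then obtain u where "u \<in> carrier U" "X = cls u" unfolding carrier_quotient by blast
    thus ?case by (simp only: star_cls US.star_star starU_closed)
  qed (simp_all add: S.m_assoc S.l_distr S.r_distr)
qed

text \<open>
  Both equations can be tested by acting on \<open>b\<close> in \<open>R\<close>. For \<open>y\<close> the class of \<open>v\<close>, the elements
  \<open>v b\<close> lie in \<open>R\<close>, and the hypothesis compares the actions of \<open>u\<close> and \<open>p\<close> on them.
\<close>

lemma cls_mult_zero_iff_fixed:
  assumes u: "u \<in> carrier U" and p: "p \<in> carrier U" and y: "y \<in> carrier S"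
    and fixed: "\<And>b. b \<in> carrier R \<Longrightarrow>
      unitization_act R u b = \<zero>\<^bsub>R\<^esub> \<longleftrightarrow> unitization_act R p b = b"
  shows "cls u \<otimes>\<^bsub>S\<^esub> y = \<zero>\<^bsub>S\<^esub> \<longleftrightarrow> cls p \<otimes>\<^bsub>S\<^esub> y = y"
proof -
  interpret U: ring U by (rule ring_unitization)
  obtain v where v: "v \<in> carrier U" and yv: "y = cls v" using y unfolding carrier_quotient by blast
  have vb: "unitization_act R v b \<in> carrier R" if "b \<in> carrier R" for b
    using act_closed[OF v[unfolded carrier_U] that] .
  have "cls p \<otimes>\<^bsub>S\<^esub> y = y \<longleftrightarrow>
    (\<forall>b\<in>carrier R. unitization_act R p (unitization_act R v b) = unitization_act R v b)"
    using p v act_mult[of p v] unfolding yv cls_hom(2)[OF p v, symmetric]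
      cls_eq_iff[OF U.m_closed[OF p v] v] by (simp add: carrier_U)
  moreover have "cls u \<otimes>\<^bsub>S\<^esub> y = \<zero>\<^bsub>S\<^esub> \<longleftrightarrow>
    (\<forall>b\<in>carrier R. unitization_act R p (unitization_act R v b) = unitization_act R v b)"
    unfolding yv cls_mult_eq_zero_iff[OF u v] using fixed vb by simp
  ultimately show ?thesis by blast
qed

text \<open>The annihilator consists of the elements fixed by the idempotent \<open>p\<close>, which form \<open>p S\<close>.\<close>

lemma right_annihilator_cls:
  assumes u: "u \<in> carrier U" and p: "p \<in> carrier U" and idem: "cls p \<otimes>\<^bsub>S\<^esub> cls p = cls p"
    and fixed: "\<And>b. b \<in> carrier R \<Longrightarrow>
      unitization_act R u b = \<zero>\<^bsub>R\<^esub> \<longleftrightarrow> unitization_act R p b = b"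
  shows "right_annihilator S {cls u} = {cls p \<otimes>\<^bsub>S\<^esub> y | y. y \<in> carrier S}"
proof -
  interpret S: ring S by (rule ring_quotient)
  have pS: "cls p \<in> carrier S" using p by (simp add: carrier_quotient)
  have fixed_iff: "cls u \<otimes>\<^bsub>S\<^esub> y = \<zero>\<^bsub>S\<^esub> \<longleftrightarrow> cls p \<otimes>\<^bsub>S\<^esub> y = y" if "y \<in> carrier S" for y
    using cls_mult_zero_iff_fixed[OF u p that fixed] .
  show ?thesis
  proof (intro equalityI subsetI)
    fix y assume "y \<in> right_annihilator S {cls u}"
    hence y: "y \<in> carrier S" and "cls u \<otimes>\<^bsub>S\<^esub> y = \<zero>\<^bsub>S\<^esub>"
      unfolding right_annihilator_def by simp_all
    hence "y = cls p \<otimes>\<^bsub>S\<^esub> y" using fixed_iff[OF y] by (simp only:)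
    thus "y \<in> {cls p \<otimes>\<^bsub>S\<^esub> y | y. y \<in> carrier S}" using y by (intro CollectI exI conjI)
  next
    fix y assume "y \<in> {cls p \<otimes>\<^bsub>S\<^esub> y | y. y \<in> carrier S}"
    then obtain z where z: "z \<in> carrier S" and y: "y = cls p \<otimes>\<^bsub>S\<^esub> z" by blast
    have yS: "y \<in> carrier S" using z pS y by (simp only: S.m_closed)
    have "cls p \<otimes>\<^bsub>S\<^esub> y = y" unfolding y S.m_assoc[OF pS pS z, symmetric] idem ..
    thus "y \<in> right_annihilator S {cls u}"
      using yS fixed_iff[OF yS] unfolding right_annihilator_def by simp
  qed
qed

section \<open>The embedding and right projections\<close>

lemma embed_closed: "x \<in> carrier R \<Longrightarrow> (x, \<zero>\<^bsub>K\<^esub>) \<in> carrier U"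
  by (simp add: carrier_U)

lemma act_embed:
  "\<lbrakk>x \<in> carrier R; b \<in> carrier R\<rbrakk> \<Longrightarrow> unitization_act R (x, \<zero>\<^bsub>K\<^esub>) b = x \<otimes>\<^bsub>R\<^esub> b"
  by (simp add: unitization_act_def R_star.rng_m_closed)

lemma embed_carrier: "x \<in> carrier R \<Longrightarrow> \<iota> x \<in> carrier S"
  unfolding carrier_quotient by (intro imageI embed_closed)

lemma embed_add:
  assumes "x \<in> carrier R" "y \<in> carrier R" shows "\<iota> (x \<oplus>\<^bsub>R\<^esub> y) = \<iota> x \<oplus>\<^bsub>S\<^esub> \<iota> y"
proof -
  have "(x \<oplus>\<^bsub>R\<^esub> y, \<zero>\<^bsub>K\<^esub>) = (x, \<zero>\<^bsub>K\<^esub>) \<oplus>\<^bsub>U\<^esub> (y, \<zero>\<^bsub>K\<^esub>)"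
    using assms by (simp add: unitization_def)
  thus ?thesis using cls_hom(1)[OF assms[THEN embed_closed]] by (simp only:)
qed

lemma embed_mult:
  assumes "x \<in> carrier R" "y \<in> carrier R" shows "\<iota> (x \<otimes>\<^bsub>R\<^esub> y) = \<iota> x \<otimes>\<^bsub>S\<^esub> \<iota> y"
proof -
  have "(x \<otimes>\<^bsub>R\<^esub> y, \<zero>\<^bsub>K\<^esub>) = (x, \<zero>\<^bsub>K\<^esub>) \<otimes>\<^bsub>U\<^esub> (y, \<zero>\<^bsub>K\<^esub>)"
    using assms by (simp add: unitization_def unitization_act_def R_star.rng_m_closed)
  thus ?thesis using cls_hom(2)[OF assms[THEN embed_closed]] by (simp only:)
qed

lemma embed_star: "x \<in> carrier R \<Longrightarrow> \<iota> (starR x) = starS (\<iota> x)"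
  unfolding star_cls[OF embed_closed] unitization_star_def by (simp add: K_star.star_zero)

lemma embed_hom: "\<iota> \<in> star_ring_hom R starR S starS"
  unfolding star_ring_hom_def mem_Collect_eq
  by (intro conjI ballI funcsetI embed_carrier embed_add embed_mult embed_star)

text \<open>The quotient identifies nothing in \<open>R\<close>, since no nonzero element of \<open>R\<close> annihilates \<open>R\<close>.\<close>

lemma embed_inj: "inj_on \<iota> (carrier R)"
proof (rule inj_onI)
  fix x y assume x: "x \<in> carrier R" and y: "y \<in> carrier R" and eq: "\<iota> x = \<iota> y"
  have eq_act: "\<forall>b\<in>carrier R. unitization_act R (x, \<zero>\<^bsub>K\<^esub>) b = unitization_act R (y, \<zero>\<^bsub>K\<^esub>) b"
    using eq cls_eq_iff[OF embed_closed[OF x] embed_closed[OF y]] by (rule iffD1[rotated])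
  have d: "x \<ominus>\<^bsub>R\<^esub> y \<in> carrier R" using x y by (rule M.minus_closed)
  have "(x \<ominus>\<^bsub>R\<^esub> y) \<otimes>\<^bsub>R\<^esub> b = \<zero>\<^bsub>R\<^esub>" if b: "b \<in> carrier R" for b
  proof -
    have "x \<otimes>\<^bsub>R\<^esub> b = y \<otimes>\<^bsub>R\<^esub> b"
      using bspec[OF eq_act b] unfolding act_embed[OF x b] act_embed[OF y b] .
    thus ?thesis
      using R_star.rng_l_diff[OF x y b] R_star.minus_self[OF R_star.rng_m_closed[OF y b]]
      by (simp only:)
  qed
  hence "x \<ominus>\<^bsub>R\<^esub> y = \<zero>\<^bsub>R\<^esub>" by (rule zero_if_right_mult_zero[OF d])
  thus "x = y" using R_star.minus_eq_zero_iff[OF x y] by (rule iffD1[rotated])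
qed

lemma projection_embed:
  assumes "projection R starR e" shows "projection S starS (\<iota> e)"
proof -
  have e: "e \<in> carrier R" "starR e = e" "e \<otimes>\<^bsub>R\<^esub> e = e" using assms by (auto simp: projection_def)
  show ?thesis
    unfolding projection_def embed_star[OF e(1), symmetric] embed_mult[OF e(1) e(1), symmetric] e(2,3)
    using embed_carrier[OF e(1)] by simp
qed

text \<open>
  By faithfulness, \<open>x y = 0\<close> in \<open>S\<close> means \<open>x (y b) = 0\<close> for all \<open>b\<close> in \<open>R\<close>, where \<open>y b\<close> is in \<open>R\<close>;
  there \<open>x\<close> can be replaced by its right projection.
\<close>

lemma RP_embed:
  assumes x: "x \<in> carrier R"
  shows "RP S starS (\<iota> x) = \<iota> (RP R starR x)"
proof -
  have e: "RP R starR x \<in> carrier R" using RP_closed[OF x] .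
  have "\<iota> x \<otimes>\<^bsub>S\<^esub> y = \<zero>\<^bsub>S\<^esub> \<longleftrightarrow> \<iota> (RP R starR x) \<otimes>\<^bsub>S\<^esub> y = \<zero>\<^bsub>S\<^esub>"
    if y: "y \<in> carrier S" for y
  proof -
    obtain v where v: "v \<in> carrier U" and yv: "y = cls v" using y unfolding carrier_quotient by blast
    have "unitization_act R v b \<in> carrier R" if "b \<in> carrier R" for b
      using act_closed[OF v[unfolded carrier_U] that] .
    thus ?thesis
      unfolding yv cls_mult_eq_zero_iff[OF embed_closed[OF x] v]
        cls_mult_eq_zero_iff[OF embed_closed[OF e] v]
      using x e RP_mult_zero_iff[OF x] by (simp add: act_embed)
  qed
  moreover have "\<iota> x \<otimes>\<^bsub>S\<^esub> \<iota> (RP R starR x) = \<iota> x"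
    unfolding embed_mult[OF x e, symmetric] mult_RP[OF x] ..
  ultimately have "is_RP S starS (\<iota> x) (\<iota> (RP R starR x))"
    using projection_embed[OF projection_RP[OF x]] by (simp add: is_RP_def)
  thus ?thesis
    unfolding RP_def[of S]
    using star_ring.is_RP_unique[OF star_ring_quotient embed_carrier[OF x]]
    by (intro the_equality)
qed

section \<open>Annihilators in the quotient\<close>

lemma star_one: "starK \<one>\<^bsub>K\<^esub> = \<one>\<^bsub>K\<^esub>"
  using K_star.star_mult[of "starK \<one>\<^bsub>K\<^esub>" "\<one>\<^bsub>K\<^esub>"] K_star.star_star[of "\<one>\<^bsub>K\<^esub>"]
    K_star.star_closed[of "\<one>\<^bsub>K\<^esub>"] by simp

text \<open>
  The projection generating the annihilator is \<open>1 - RP(a)\<close>, the class of the pair \<open>(- RP(a), 1)\<close>: it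
  fixes \<open>b\<close> if and only if \<open>RP(a) b = 0\<close>, which means \<open>a b = 0\<close>.
\<close>

lemma rickart_embed:
  assumes a: "a \<in> carrier R"
  shows "\<exists>p. projection S starS p \<and>
    right_annihilator S {\<iota> a} = {p \<otimes>\<^bsub>S\<^esub> y | y. y \<in> carrier S}"
proof -
  define e where "e = RP R starR a"
  have e: "projection R starR e" using a by (simp add: e_def projection_RP)
  have ec: "e \<in> carrier R" "starR e = e" "e \<otimes>\<^bsub>R\<^esub> e = e" using e by (auto simp: projection_def)
  define p where "p = (\<ominus>\<^bsub>R\<^esub> e, \<one>\<^bsub>K\<^esub>)"
  have p: "p \<in> carrier U" using ec by (simp add: p_def carrier_U)
  have act_p: "unitization_act R p b = b \<ominus>\<^bsub>R\<^esub> e \<otimes>\<^bsub>R\<^esub> b" if b: "b \<in> carrier R" for b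
  proof -
    have "\<ominus>\<^bsub>R\<^esub> e = \<zero>\<^bsub>R\<^esub> \<ominus>\<^bsub>R\<^esub> e" using ec by (simp add: a_minus_def)
    hence "(\<ominus>\<^bsub>R\<^esub> e) \<otimes>\<^bsub>R\<^esub> b = \<ominus>\<^bsub>R\<^esub> (e \<otimes>\<^bsub>R\<^esub> b)"
      using ec b R_star.rng_l_diff[of "\<zero>\<^bsub>R\<^esub>" e b]
      by (simp add: R_star.rng_l_null R_star.rng_m_closed a_minus_def)
    thus ?thesis using ec b
      by (simp add: p_def unitization_act_def a_minus_def M.a_comm R_star.rng_m_closed)
  qed
  have "starR (\<ominus>\<^bsub>R\<^esub> e) = \<ominus>\<^bsub>R\<^esub> e"
    using R_star.star_diff[of "\<zero>\<^bsub>R\<^esub>" e] ec by (simp add: R_star.star_zero a_minus_def)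
  hence "starU p = p" by (simp add: p_def unitization_star_def star_one)
  hence star_p: "starS (cls p) = cls p" using star_cls[OF p] by (simp only:)
  have idem: "cls p \<otimes>\<^bsub>S\<^esub> cls p = cls p"
  proof -
    interpret U: ring U by (rule ring_unitization)
    have pRK: "p \<in> carrier R \<times> carrier K" using p by (simp add: carrier_U)
    have "unitization_act R (p \<otimes>\<^bsub>U\<^esub> p) b = unitization_act R p b" if b: "b \<in> carrier R" for b
    proof -
      have eb: "e \<otimes>\<^bsub>R\<^esub> b \<in> carrier R" using ec b by (simp add: R_star.rng_m_closed)
      have "e \<otimes>\<^bsub>R\<^esub> (e \<otimes>\<^bsub>R\<^esub> b) = e \<otimes>\<^bsub>R\<^esub> b" using R_star.rng_m_assoc[OF ec(1) ec(1) b] ec by simp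
      thus ?thesis
        using b eb ec act_mult[OF pRK pRK b]
        by (simp add: act_p R_star.rng_r_diff R_star.minus_self R_star.minus_zero)
    qed
    thus ?thesis
      unfolding cls_hom(2)[OF p p, symmetric] cls_eq_iff[OF U.m_closed[OF p p] p]
      by (intro ballI)
  qed
  have "cls p \<in> carrier S" unfolding carrier_quotient using p by (rule imageI)
  hence proj_p: "projection S starS (cls p)"
    unfolding projection_def using star_p idem by (intro conjI)
  have fixed: "unitization_act R (a, \<zero>\<^bsub>K\<^esub>) b = \<zero>\<^bsub>R\<^esub> \<longleftrightarrow> unitization_act R p b = b"
    if b: "b \<in> carrier R" for b
  proof -
    have eb: "e \<otimes>\<^bsub>R\<^esub> b \<in> carrier R" using ec b by (simp add: R_star.rng_m_closed)
    have "b \<ominus>\<^bsub>R\<^esub> e \<otimes>\<^bsub>R\<^esub> b = b \<longleftrightarrow> e \<otimes>\<^bsub>R\<^esub> b = \<zero>\<^bsub>R\<^esub>"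
    proof
      assume "b \<ominus>\<^bsub>R\<^esub> e \<otimes>\<^bsub>R\<^esub> b = b"
      hence "b \<oplus>\<^bsub>R\<^esub> e \<otimes>\<^bsub>R\<^esub> b = b" using R_star.minus_plus_cancel[OF b eb] by (simp only:)
      thus "e \<otimes>\<^bsub>R\<^esub> b = \<zero>\<^bsub>R\<^esub>" using b eb by simp
    qed (simp add: R_star.minus_zero[OF b])
    thus ?thesis
      using a b RP_mult_zero_iff[OF a b] by (simp add: act_p act_embed e_def)
  qed
  show ?thesis
    using proj_p right_annihilator_cls[OF embed_closed[OF a] p idem fixed]
    by (intro exI[of _ "cls p"] conjI)
qed

lemma rickart_quotient:
  assumes "\<forall>l \<in> carrier K - {\<zero>\<^bsub>K\<^esub>}. \<exists>e. projection R starR e \<and>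
           (\<forall>x\<in>carrier R. l \<odot>\<^bsub>R\<^esub> x = \<zero>\<^bsub>R\<^esub> \<longrightarrow> proj_le R (LP R starR x) e)"
  shows "rickart_star_ring S starS"
proof (intro rickart_star_ring.intro rickart_star_ring_axioms.intro star_ring_quotient)
  fix s assume "s \<in> carrier S"
  then obtain a l where al: "a \<in> carrier R" "l \<in> carrier K" and s: "s = cls (a, l)"
    by (auto simp: carrier_quotient carrier_U)
  show "\<exists>p. projection S starS p \<and> right_annihilator S {s} = {p \<otimes>\<^bsub>S\<^esub> y | y. y \<in> carrier S}"
  proof (cases "l = \<zero>\<^bsub>K\<^esub>")
    case True
    show ?thesis unfolding s True by (rule rickart_embed[OF al(1)])
  next
    case False
    then obtain e where "projection R starR e"
      "\<forall>x\<in>carrier R. l \<odot>\<^bsub>R\<^esub> x = \<zero>\<^bsub>R\<^esub> \<longrightarrow> proj_le R (LP R starR x) e"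
      using assms al by blast
    then obtain h where h: "projection R starR h"
      and hy: "\<And>y. y \<in> carrier R \<Longrightarrow> unitization_act R (a, l) y = \<zero>\<^bsub>R\<^esub> \<longleftrightarrow> h \<otimes>\<^bsub>R\<^esub> y = y"
      using act_zero_projection[OF al] by blast
    have hc: "h \<in> carrier R" using h by (simp add: projection_def)
    have pS: "projection S starS (\<iota> h)" by (rule projection_embed[OF h])
    hence idem: "\<iota> h \<otimes>\<^bsub>S\<^esub> \<iota> h = \<iota> h" unfolding projection_def by (elim conjE)
    have "(a, l) \<in> carrier U" using al by (simp add: carrier_U)
    hence "right_annihilator S {cls (a, l)} = {\<iota> h \<otimes>\<^bsub>S\<^esub> y | y. y \<in> carrier S}"
      by (rule right_annihilator_cls[OF _ embed_closed[OF hc] idem])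
        (simp add: act_embed[OF hc] hy)
    thus ?thesis unfolding s by (intro exI[of _ "\<iota> h"] conjI pS)
  qed
qed

end

theorem theorem2p9:
  fixes K :: "('k, 'p) ring_scheme" and starK :: "'k \<Rightarrow> 'k"
    and R :: "('k, 'a, 'm) module_scheme" and starR :: "'a \<Rightarrow> 'a"
  assumes "weakly_rickart_star_ring R starR"
    and "star_algebra K starK R starR"
    and "\<forall>l \<in> carrier K - {\<zero>\<^bsub>K\<^esub>}. \<exists>e. projection R starR e \<and>
           (\<forall>x\<in>carrier R. l \<odot>\<^bsub>R\<^esub> x = \<zero>\<^bsub>R\<^esub> \<longrightarrow> proj_le R (LP R starR x) e)"
  shows "\<exists>(S :: ('a \<times> 'k) set ring) starS \<phi>.
           rickart_star_ring S starS \<and>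
           \<phi> \<in> star_ring_hom R starR S starS \<and> inj_on \<phi> (carrier R) \<and>
           (\<forall>x\<in>carrier R. RP S starS (\<phi> x) = \<phi> (RP R starR x))"
proof -
  have W: "weakly_rickart_star_algebra K starK R starR"
    using assms(1,2) by (rule weakly_rickart_star_algebra.intro[rotated])
  show ?thesis
    by (rule exI[of _ "unitization K R Quot act_kernel K R"],
        rule exI[of _ "\<lambda>X. unitization_star starK starR ` X"],
        rule exI[of _ "\<lambda>x. act_kernel K R +>\<^bsub>unitization K R\<^esub> (x, \<zero>\<^bsub>K\<^esub>)"],
        intro conjI ballI
          weakly_rickart_star_algebra.rickart_quotient[OF W assms(3)]
          weakly_rickart_star_algebra.embed_hom[OF W]
          weakly_rickart_star_algebra.embed_inj[OF W]
          weakly_rickart_star_algebra.RP_embed[OF W])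
qed

end
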